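(* Let $\Sigma$ be a set, $\Sigma_\tau=\Sigma+\{\tau\}$. The monad $\mathcal{P}(\Sigma_\tau\times\mathcal{I}d)$ on $\mathsf{Set}$ described in the context is an ordered saturation monad, with saturation of $\alpha:X\to\mathcal{P}(\Sigma_\tau\times X)$ given by $(m_X\cdot\overline{\Sigma_\tau}\alpha)^*\cdot e_X$, where $\cdot$ is relational composition and $(-)^*$ is reflexive–transitive closure of a relation (as explained in the context).
   Context: Maps $X\to\mathcal{P}Y$ are identified with relations from $X$ to $Y$; $\cdot$ denotes their composition $g\cdot f(x)=\bigcup_{y\in f(x)}g(y)$, and for $\beta:Z\to\mathcal{P}Z$, $\beta^*$ is the reflexive–transitive closure, $\beta^*(z)=\bigcup_{n\ge0}\beta^n(z)$. The monad $\mathcal{P}(\Sigma_\tau\times\mathcal{I}d)$ has unit $x\mapsto\{(\tau,x)\}$ and Kleisli composition, for $f:X\to\mathcal{P}(\Sigma_\tau\times Y)$, $g:Y\to\mathcal{P}(\Sigma_\tau\times Z)$: $g\bullet f(x)=\{(\sigma,z)\mid\exists y:\ ((\sigma,y)\in f(x)\text{ and }(\tau,z)\in g(y))\text{ or }((\tau,y)\in f(x)\text{ and }(\sigma,z)\in g(y))\}$; Kleisli hom-sets are ordered pointwise by inclusion. For $\alpha:X\to\mathcal{P}(\Sigma_\tau\times X)$: $\overline{\Sigma_\tau}\alpha:\Sigma_\tau\times X\to\mathcal{P}(\Sigma_\tau\times\Sigma_\tau\times X)$, $(\sigma,x)\mapsto\{(\sigma,\sigma',x')\mid(\sigma',x')\in\alpha(x)\}$;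 $m_X:\Sigma_\tau\times\Sigma_\tau\times X\to\mathcal{P}(\Sigma_\tau\times X)$ sends $(\sigma_1,\tau,x)\mapsto\{(\sigma_1,x)\}$, $(\tau,\sigma_2,x)\mapsto\{(\sigma_2,x)\}$, and $(\sigma_1,\sigma_2,x)\mapsto\varnothing$ if $\sigma_1,\sigma_2\ne\tau$; $e_X(x)=\{(\tau,x)\}$. Ordered saturation monad (for a monad $M$ on $\mathsf{Set}$ with Kleisli composition $\bullet$, identities $1$, and $f^\sharp$ the Kleisli morphism induced by a map $f$, here $f^\sharp(x)=\{(\tau,f(x))\}$): Kleisli hom-sets are posets with monotone composition and for each $\alpha:X\rightsquigarrow X$ there is $\alpha^\star$ with (1) $1\le\alpha^\star$; (2) $\alpha\le\alpha^\star$; (3) $\alpha^\star\bullet\alpha^\star\le\alpha^\star$; (4) $\alpha^\star\le\beta$ whenever $1\le\beta$, $\alpha\le\beta$, $\beta\bullet\beta\le\beta$; (5) for every map $f:X\to Y$ and $\beta:Y\rightsquigarrow Y$, $f^\sharp\bullet\alpha\le\beta\bullet f^\sharp\Rightarrow f^\sharp\bullet\alpha^\star\le\beta^\star\bullet f^\sharp$, and likewise with $\ge$. *)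

theory Defs
  imports "HOL-Library.FuncSet"
begin

text \<open>
  Sets are subsets of a type \<^typ>\<open>'u\<close>, which stays polymorphic; a map out of \<open>X\<close> is an extensional
  function, so equality of morphisms is equality of HOL functions. As \<open>T X\<close> need not be a
  set of elements of \<^typ>\<open>'u\<close>, monads are presented by unit and Kleisli composition (Manes' clone form):
  \<open>kcomp X Y Z g f\<close> is the composite \<open>g \<bullet> f\<close> of \<open>f : X \<leadsto> Y\<close> and \<open>g : Y \<leadsto> Z\<close>. The law \<open>kcomp_sharp\<close>
  ties Kleisli composition to composition of maps; a category structure on the Kleisli
  homs alone would not determine a monad.
\<close>

definition sharp :: "('u set \<Rightarrow> 'u \<Rightarrow> 'm) \<Rightarrow> 'u set \<Rightarrow> 'u set \<Rightarrow> ('u \<Rightarrow> 'u) \<Rightarrow> 'u \<Rightarrow> 'm" where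
  "sharp eta X Y f = (\<lambda>x\<in>X. eta Y (f x))"

locale set_monad =
  fixes T :: "'u set \<Rightarrow> 'm set"
    and eta :: "'u set \<Rightarrow> 'u \<Rightarrow> 'm"
    and kcomp :: "'u set \<Rightarrow> 'u set \<Rightarrow> 'u set \<Rightarrow> ('u \<Rightarrow> 'm) \<Rightarrow> ('u \<Rightarrow> 'm) \<Rightarrow> 'u \<Rightarrow> 'm"
  assumes eta_hom: "\<And>X. eta X \<in> X \<rightarrow>\<^sub>E T X"
    and kcomp_hom: "\<And>X Y Z f g. \<lbrakk>f \<in> X \<rightarrow>\<^sub>E T Y; g \<in> Y \<rightarrow>\<^sub>E T Z\<rbrakk> \<Longrightarrow> kcomp X Y Z g f \<in> X \<rightarrow>\<^sub>E T Z"
    and eta_left: "\<And>X Y f. f \<in> X \<rightarrow>\<^sub>E T Y \<Longrightarrow> kcomp X Y Y (eta Y) f = f"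
    and eta_right: "\<And>X Y f. f \<in> X \<rightarrow>\<^sub>E T Y \<Longrightarrow> kcomp X X Y f (eta X) = f"
    and kcomp_assoc:
      "\<And>W X Y Z f g h. \<lbrakk>f \<in> W \<rightarrow>\<^sub>E T X; g \<in> X \<rightarrow>\<^sub>E T Y; h \<in> Y \<rightarrow>\<^sub>E T Z\<rbrakk> \<Longrightarrow>
        kcomp W X Z (kcomp X Y Z h g) f = kcomp W Y Z h (kcomp W X Y g f)"
    and kcomp_sharp:
      "\<And>X Y Z f g. \<lbrakk>f \<in> X \<rightarrow>\<^sub>E Y; g \<in> Y \<rightarrow>\<^sub>E T Z\<rbrakk> \<Longrightarrow> kcomp X Y Z g (sharp eta X Y f) = (\<lambda>x\<in>X. g (f x))"

locale ordered_set_monad = set_monad T eta kcomp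
  for T :: "'u set \<Rightarrow> 'm set"
    and eta :: "'u set \<Rightarrow> 'u \<Rightarrow> 'm"
    and kcomp :: "'u set \<Rightarrow> 'u set \<Rightarrow> 'u set \<Rightarrow> ('u \<Rightarrow> 'm) \<Rightarrow> ('u \<Rightarrow> 'm) \<Rightarrow> 'u \<Rightarrow> 'm" +
  fixes le :: "'u set \<Rightarrow> 'u set \<Rightarrow> ('u \<Rightarrow> 'm) \<Rightarrow> ('u \<Rightarrow> 'm) \<Rightarrow> bool"
  assumes le_refl: "\<And>X Y f. f \<in> X \<rightarrow>\<^sub>E T Y \<Longrightarrow> le X Y f f"
    and le_trans:
      "\<And>X Y f g h. \<lbrakk>f \<in> X \<rightarrow>\<^sub>E T Y; g \<in> X \<rightarrow>\<^sub>E T Y; h \<in> X \<rightarrow>\<^sub>E T Y;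
        le X Y f g; le X Y g h\<rbrakk> \<Longrightarrow> le X Y f h"
    and le_antisym:
      "\<And>X Y f g. \<lbrakk>f \<in> X \<rightarrow>\<^sub>E T Y; g \<in> X \<rightarrow>\<^sub>E T Y; le X Y f g; le X Y g f\<rbrakk> \<Longrightarrow> f = g"
    and kcomp_mono:
      "\<And>X Y Z f f' g g'. \<lbrakk>f \<in> X \<rightarrow>\<^sub>E T Y; f' \<in> X \<rightarrow>\<^sub>E T Y;
        g \<in> Y \<rightarrow>\<^sub>E T Z; g' \<in> Y \<rightarrow>\<^sub>E T Z; le X Y f f'; le Y Z g g'\<rbrakk> \<Longrightarrow>
        le X Z (kcomp X Y Z g f) (kcomp X Y Z g' f')"

locale ordered_saturation_monad = ordered_set_monad T eta kcomp le
  for T :: "'u set \<Rightarrow> 'm set"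
    and eta :: "'u set \<Rightarrow> 'u \<Rightarrow> 'm"
    and kcomp :: "'u set \<Rightarrow> 'u set \<Rightarrow> 'u set \<Rightarrow> ('u \<Rightarrow> 'm) \<Rightarrow> ('u \<Rightarrow> 'm) \<Rightarrow> 'u \<Rightarrow> 'm"
    and le :: "'u set \<Rightarrow> 'u set \<Rightarrow> ('u \<Rightarrow> 'm) \<Rightarrow> ('u \<Rightarrow> 'm) \<Rightarrow> bool" +
  fixes sat :: "'u set \<Rightarrow> ('u \<Rightarrow> 'm) \<Rightarrow> 'u \<Rightarrow> 'm"
  assumes sat_hom: "\<And>X \<alpha>. \<alpha> \<in> X \<rightarrow>\<^sub>E T X \<Longrightarrow> sat X \<alpha> \<in> X \<rightarrow>\<^sub>E T X"
    and sat_unit: "\<And>X \<alpha>. \<alpha> \<in> X \<rightarrow>\<^sub>E T X \<Longrightarrow> le X X (eta X) (sat X \<alpha>)"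
    and sat_extensive: "\<And>X \<alpha>. \<alpha> \<in> X \<rightarrow>\<^sub>E T X \<Longrightarrow> le X X \<alpha> (sat X \<alpha>)"
    and sat_trans:
      "\<And>X \<alpha>. \<alpha> \<in> X \<rightarrow>\<^sub>E T X \<Longrightarrow> le X X (kcomp X X X (sat X \<alpha>) (sat X \<alpha>)) (sat X \<alpha>)"
    and sat_least:
      "\<And>X \<alpha> \<beta>. \<lbrakk>\<alpha> \<in> X \<rightarrow>\<^sub>E T X; \<beta> \<in> X \<rightarrow>\<^sub>E T X;
        le X X (eta X) \<beta>; le X X \<alpha> \<beta>; le X X (kcomp X X X \<beta> \<beta>) \<beta>\<rbrakk> \<Longrightarrow> le X X (sat X \<alpha>) \<beta>"
    and sat_forward:
      "\<And>X Y f \<alpha> \<beta>. \<lbrakk>\<alpha> \<in> X \<rightarrow>\<^sub>E T X; \<beta> \<in> Y \<rightarrow>\<^sub>E T Y; f \<in> X \<rightarrow>\<^sub>E Y;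
        le X Y (kcomp X X Y (sharp eta X Y f) \<alpha>) (kcomp X Y Y \<beta> (sharp eta X Y f))\<rbrakk> \<Longrightarrow>
        le X Y (kcomp X X Y (sharp eta X Y f) (sat X \<alpha>)) (kcomp X Y Y (sat Y \<beta>) (sharp eta X Y f))"
    and sat_backward:
      "\<And>X Y f \<alpha> \<beta>. \<lbrakk>\<alpha> \<in> X \<rightarrow>\<^sub>E T X; \<beta> \<in> Y \<rightarrow>\<^sub>E T Y; f \<in> X \<rightarrow>\<^sub>E Y;
        le X Y (kcomp X Y Y \<beta> (sharp eta X Y f)) (kcomp X X Y (sharp eta X Y f) \<alpha>)\<rbrakk> \<Longrightarrow>
        le X Y (kcomp X Y Y (sat Y \<beta>) (sharp eta X Y f)) (kcomp X X Y (sharp eta X Y f) (sat X \<alpha>))"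

definition rel_comp :: "'a set \<Rightarrow> ('b \<Rightarrow> 'c set) \<Rightarrow> ('a \<Rightarrow> 'b set) \<Rightarrow> 'a \<Rightarrow> 'c set" where
  "rel_comp X g f = (\<lambda>x\<in>X. \<Union>y\<in>f x. g y)"

definition rel_star :: "'a set \<Rightarrow> ('a \<Rightarrow> 'a set) \<Rightarrow> 'a \<Rightarrow> 'a set" where
  "rel_star Z \<beta> = (\<lambda>z\<in>Z. \<Union>n. ({(u, v). u \<in> Z \<and> v \<in> \<beta> u} ^^ n) `` {z})"

text \<open>Labels with a silent step: \<^const>\<open>None\<close> is \<open>\<tau>\<close>.\<close>

definition labels :: "'s set \<Rightarrow> 's option set" where
  "labels \<Sigma> = insert None (Some ` \<Sigma>)"

definition lts_T :: "'s set \<Rightarrow> 'u set \<Rightarrow> ('s option \<times> 'u) set set" where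
  "lts_T \<Sigma> X = Pow (labels \<Sigma> \<times> X)"

definition lts_eta :: "'u set \<Rightarrow> 'u \<Rightarrow> ('s option \<times> 'u) set" where
  "lts_eta X = (\<lambda>x\<in>X. {(None, x)})"

definition lts_kcomp ::
  "'s set \<Rightarrow> 'u set \<Rightarrow> 'u set \<Rightarrow> 'u set \<Rightarrow> ('u \<Rightarrow> ('s option \<times> 'u) set) \<Rightarrow>
    ('u \<Rightarrow> ('s option \<times> 'u) set) \<Rightarrow> 'u \<Rightarrow> ('s option \<times> 'u) set" where
  "lts_kcomp \<Sigma> X Y Z g f =
    (\<lambda>x\<in>X. {(\<sigma>, z). \<sigma> \<in> labels \<Sigma> \<and> z \<in> Z \<and>
      (\<exists>y\<in>Y. (\<sigma>, y) \<in> f x \<and> (None, z) \<in> g y \<or> (None, y) \<in> f x \<and> (\<sigma>, z) \<in> g y)})"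

definition lts_le ::
  "'u set \<Rightarrow> 'u set \<Rightarrow> ('u \<Rightarrow> ('s option \<times> 'u) set) \<Rightarrow> ('u \<Rightarrow> ('s option \<times> 'u) set) \<Rightarrow> bool" where
  "lts_le X Y f g \<longleftrightarrow> (\<forall>x\<in>X. f x \<subseteq> g x)"

definition lts_lift ::
  "'s set \<Rightarrow> 'u set \<Rightarrow> ('u \<Rightarrow> ('s option \<times> 'u) set) \<Rightarrow>
    's option \<times> 'u \<Rightarrow> ('s option \<times> 's option \<times> 'u) set" where
  "lts_lift \<Sigma> X \<alpha> = (\<lambda>(\<sigma>, x)\<in>labels \<Sigma> \<times> X. {(\<sigma>, \<sigma>', x') |\<sigma>' x'. (\<sigma>', x') \<in> \<alpha> x})"

definition lts_m ::
  "'s set \<Rightarrow> 'u set \<Rightarrow> 's option \<times> 's option \<times> 'u \<Rightarrow> ('s option \<times> 'u) set" where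
  "lts_m \<Sigma> X = (\<lambda>(\<sigma>\<^sub>1, \<sigma>\<^sub>2, x)\<in>labels \<Sigma> \<times> labels \<Sigma> \<times> X.
    if \<sigma>\<^sub>2 = None then {(\<sigma>\<^sub>1, x)} else if \<sigma>\<^sub>1 = None then {(\<sigma>\<^sub>2, x)} else {})"

definition lts_e :: "'u set \<Rightarrow> 'u \<Rightarrow> ('s option \<times> 'u) set" where
  "lts_e X = (\<lambda>x\<in>X. {(None, x)})"

definition lts_sat ::
  "'s set \<Rightarrow> 'u set \<Rightarrow> ('u \<Rightarrow> ('s option \<times> 'u) set) \<Rightarrow> 'u \<Rightarrow> ('s option \<times> 'u) set" where
  "lts_sat \<Sigma> X \<alpha> =
    rel_comp X
      (rel_star (labels \<Sigma> \<times> X) (rel_comp (labels \<Sigma> \<times> X) (lts_m \<Sigma> X) (lts_lift \<Sigma> X \<alpha>)))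
      (lts_e X)"

end

theory Submission
  imports Defs
begin

text \<open>
  The saturation relates \<open>x\<close> to \<open>(\<sigma>, z)\<close> iff \<open>z\<close> is reached from \<open>x\<close> by a finite run of
  \<open>\<alpha>\<close>-steps with at most one visible label, namely \<open>\<sigma>\<close> (none if \<open>\<sigma> = \<tau>\<close>). In this inductive form,
  transitivity is concatenation of runs, and leastness and the two transfer properties along maps
  follow by extending runs one step at a time.
\<close>

inductive weak_step :: "('u \<Rightarrow> ('s option \<times> 'u) set) \<Rightarrow> 'u \<Rightarrow> 's option \<Rightarrow> 'u \<Rightarrow> bool"
  for \<alpha> x where
  refl: "weak_step \<alpha> x None x"
| silent: "\<lbrakk>weak_step \<alpha> x \<sigma> y; (None, z) \<in> \<alpha> y\<rbrakk> \<Longrightarrow> weak_step \<alpha> x \<sigma> z"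
| visible: "\<lbrakk>weak_step \<alpha> x None y; (\<sigma>, z) \<in> \<alpha> y\<rbrakk> \<Longrightarrow> weak_step \<alpha> x \<sigma> z"

text \<open>Induction on the second run, appended step by step to the silent one. With
  \<open>weak_step_trans_right\<close> this covers the two cases of Kleisli composition: the visible
  label comes from the second run or from the first.\<close>

lemma weak_step_trans_left:
  assumes "weak_step \<alpha> y \<sigma> z" "weak_step \<alpha> x None y"
  shows "weak_step \<alpha> x \<sigma> z"
  using assms by (induction rule: weak_step.induct) (auto intro: weak_step.intros)

lemma weak_step_trans_right:
  fixes \<alpha> :: "'u \<Rightarrow> ('s option \<times> 'u) set"
  assumes "weak_step \<alpha> y None z" "weak_step \<alpha> x \<sigma> y"
  shows "weak_step \<alpha> x \<sigma> z"
  using assms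
proof (induction "None :: 's option" z rule: weak_step.induct)
  case refl
  then show ?case .
next
  case (silent y' z)
  then show ?case by (blast intro: weak_step.silent)
next
  \<comment> \<open>The label of the run is fixed to \<open>None\<close>, so the step of this case
    is itself silent and extends the prefix without changing its label \<sigma>.\<close>
  case (visible y' z)
  then show ?case by (blast intro: weak_step.silent)
qed

section \<open>Typing of runs, and saturation as reachability\<close>

lemma lts_hom_closed:
  assumes "\<alpha> \<in> X \<rightarrow>\<^sub>E lts_T \<Sigma> Y" "x \<in> X" "(\<sigma>, z) \<in> \<alpha> x"
  shows "\<sigma> \<in> labels \<Sigma>" "z \<in> Y"
  using assms by (fastforce simp: lts_T_def dest: PiE_mem)+

lemma weak_step_closed:
  assumes "weak_step \<alpha> x \<sigma> z" "\<alpha> \<in> X \<rightarrow>\<^sub>E lts_T \<Sigma> X" "x \<in> X"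
  shows "\<sigma> \<in> labels \<Sigma> \<and> z \<in> X"
  using assms
  by (induction rule: weak_step.induct) (auto simp: labels_def dest: lts_hom_closed)

text \<open>The first component of a pair is the label accumulated so far. A silent step keeps it,
  and any step may set it while it is still \<open>None\<close>: these are the rules
  \<open>silent\<close> and \<open>visible\<close>. A second visible label is excluded because
  \<open>lts_m\<close> sends two visible labels to the empty set.\<close>

lemma lts_step_iff:
  assumes "\<alpha> \<in> X \<rightarrow>\<^sub>E lts_T \<Sigma> X" "\<sigma> \<in> labels \<Sigma>" "y \<in> X"
  shows "(\<sigma>', z) \<in> rel_comp (labels \<Sigma> \<times> X) (lts_m \<Sigma> X) (lts_lift \<Sigma> X \<alpha>) (\<sigma>, y) \<longleftrightarrow>
    (\<sigma>' = \<sigma> \<and> (None, z) \<in> \<alpha> y) \<or> (\<sigma> = None \<and> (\<sigma>', z) \<in> \<alpha> y)"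
proof -
  \<comment> \<open>\<open>lts_m\<close> is specified only on its domain; the typing of \<alpha>
    puts the triple there.\<close>
  have m: "lts_m \<Sigma> X (\<sigma>, \<rho>, w) =
      (if \<rho> = None then {(\<sigma>, w)} else if \<sigma> = None then {(\<rho>, w)} else {})"
    if "(\<rho>, w) \<in> \<alpha> y" for \<rho> w
    using lts_hom_closed[OF assms(1,3) that] assms(2) by (simp add: lts_m_def)
  have "(\<sigma>', z) \<in> rel_comp (labels \<Sigma> \<times> X) (lts_m \<Sigma> X) (lts_lift \<Sigma> X \<alpha>) (\<sigma>, y) \<longleftrightarrow>
      (\<exists>\<rho> w. (\<rho>, w) \<in> \<alpha> y \<and> (\<sigma>', z) \<in> lts_m \<Sigma> X (\<sigma>, \<rho>, w))"
    using assms by (auto simp: rel_comp_def lts_lift_def)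
  also have "\<dots> \<longleftrightarrow> (\<exists>\<rho> w. (\<rho>, w) \<in> \<alpha> y \<and>
      (\<sigma>', z) \<in> (if \<rho> = None then {(\<sigma>, w)} else if \<sigma> = None then {(\<rho>, w)} else {}))"
    using m by metis
  also have "\<dots> \<longleftrightarrow> (\<sigma>' = \<sigma> \<and> (None, z) \<in> \<alpha> y) \<or> (\<sigma> = None \<and> (\<sigma>', z) \<in> \<alpha> y)"
    by (auto split: if_splits)
  finally show ?thesis .
qed

text \<open>Both sides arise by appending single steps at the end, starting from
  (\<open>None\<close>, x), so each inclusion is an induction in which \<open>lts_step_iff\<close>
  translates one step.\<close>

lemma lts_sat_eq_weak_step:
  assumes \<alpha>: "\<alpha> \<in> X \<rightarrow>\<^sub>E lts_T \<Sigma> X" and x: "x \<in> X"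
  shows "lts_sat \<Sigma> X \<alpha> x = {(\<sigma>, z). weak_step \<alpha> x \<sigma> z}"
proof -
  let ?B = "rel_comp (labels \<Sigma> \<times> X) (lts_m \<Sigma> X) (lts_lift \<Sigma> X \<alpha>)"
  let ?R = "{(u, v). u \<in> labels \<Sigma> \<times> X \<and> v \<in> ?B u}"
  have None_label: "None \<in> labels \<Sigma>"
    by (simp add: labels_def)
  \<comment> \<open>\<open>lts_e\<close> supplies the start (\<open>None\<close>, x), and the union
    of all finite powers is the reflexive-transitive closure.\<close>
  have sat: "lts_sat \<Sigma> X \<alpha> x = ?R\<^sup>* `` {(None, x)}"
    using x None_label
    by (auto simp: lts_sat_def rel_comp_def[of X] lts_e_def rel_star_def rtrancl_is_UN_relpow)
  have R: "((\<sigma>, y), (\<sigma>', z)) \<in> ?R \<longleftrightarrow> \<sigma> \<in> labels \<Sigma> \<and> y \<in> X \<and>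
      ((\<sigma>' = \<sigma> \<and> (None, z) \<in> \<alpha> y) \<or> (\<sigma> = None \<and> (\<sigma>', z) \<in> \<alpha> y))" for \<sigma> y \<sigma>' z
    using lts_step_iff[OF \<alpha>] by auto
  have "weak_step \<alpha> x \<sigma> z" if "((None, x), (\<sigma>, z)) \<in> ?R\<^sup>*" for \<sigma> z
    using that
  proof (induction rule: rtrancl_induct2)
    case refl
    show ?case by (rule weak_step.refl)
  next
    case (step \<sigma> y \<sigma>' z)
    then show ?case
      unfolding R by (auto intro: weak_step.silent weak_step.visible)
  qed
  moreover have "((None, x), (\<sigma>, z)) \<in> ?R\<^sup>*" if "weak_step \<alpha> x \<sigma> z" for \<sigma> z
    using that
  proof (induction rule: weak_step.induct)
    case refl
    show ?case by simp
  next
    case (silent \<sigma> y z)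
    \<comment> \<open>The relation only has sources in \<open>labels \<Sigma> \<times> X\<close>;
      \<open>weak_step_closed\<close> places the accumulated label and the state y there.\<close>
    then have "((\<sigma>, y), (\<sigma>, z)) \<in> ?R"
      unfolding R using weak_step_closed[OF _ \<alpha> x] by blast
    with silent.IH show ?case by (rule rtrancl_into_rtrancl)
  next
    case (visible y \<sigma> z)
    then have "((None, y), (\<sigma>, z)) \<in> ?R"
      unfolding R using weak_step_closed[OF _ \<alpha> x] by blast
    with visible.IH show ?case by (rule rtrancl_into_rtrancl)
  qed
  ultimately show ?thesis
    unfolding sat by auto
qed

lemma lts_sat_hom:
  assumes "\<alpha> \<in> X \<rightarrow>\<^sub>E lts_T \<Sigma> X"
  shows "lts_sat \<Sigma> X \<alpha> \<in> X \<rightarrow>\<^sub>E lts_T \<Sigma> X"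
proof (rule PiE_I)
  fix x assume "x \<in> X"
  then show "lts_sat \<Sigma> X \<alpha> x \<in> lts_T \<Sigma> X"
    using assms weak_step_closed[OF _ assms]
    by (auto simp: lts_sat_eq_weak_step lts_T_def)
qed (simp add: lts_sat_def rel_comp_def)

section \<open>Kleisli composition and its interaction with maps\<close>

lemma lts_eta_hom: "lts_eta X \<in> X \<rightarrow>\<^sub>E lts_T \<Sigma> X"
  by (auto simp: lts_eta_def lts_T_def labels_def)

lemma lts_kcomp_hom: "lts_kcomp \<Sigma> X Y Z g f \<in> X \<rightarrow>\<^sub>E lts_T \<Sigma> Z"
  by (auto simp: lts_kcomp_def lts_T_def)

text \<open>The bounds on labels and states built into \<open>lts_kcomp\<close> follow from the
  typing of f and g, so the plain existential formula remains.\<close>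

lemma lts_kcomp_iff:
  assumes "f \<in> X \<rightarrow>\<^sub>E lts_T \<Sigma> Y" "g \<in> Y \<rightarrow>\<^sub>E lts_T \<Sigma> Z" "x \<in> X"
  shows "(\<sigma>, z) \<in> lts_kcomp \<Sigma> X Y Z g f x \<longleftrightarrow>
    (\<exists>y. (\<sigma>, y) \<in> f x \<and> (None, z) \<in> g y \<or> (None, y) \<in> f x \<and> (\<sigma>, z) \<in> g y)"
  using assms lts_hom_closed[OF assms(1,3)] lts_hom_closed[OF assms(2)]
  unfolding lts_kcomp_def by simp blast

lemma lts_hom_eqI:
  assumes "f \<in> X \<rightarrow>\<^sub>E lts_T \<Sigma> Y" "g \<in> X \<rightarrow>\<^sub>E lts_T \<Sigma> Y"
    and "\<And>x \<sigma> y. x \<in> X \<Longrightarrow> (\<sigma>, y) \<in> f x \<longleftrightarrow> (\<sigma>, y) \<in> g x"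
  shows "f = g"
  using assms by (intro PiE_ext[OF assms(1,2)]) auto

lemma sharp_lts_eta:
  assumes "f \<in> X \<rightarrow>\<^sub>E Y"
  shows "sharp lts_eta X Y f = (\<lambda>x\<in>X. {(None, f x)})"
  using assms by (auto simp: sharp_def lts_eta_def fun_eq_iff)

text \<open>The induced morphism offers only (\<open>None\<close>, f x), so the case where the first
  factor carries the label collapses into the other one.\<close>

lemma lts_kcomp_sharp_right:
  assumes "f \<in> X \<rightarrow>\<^sub>E Y" "g \<in> Y \<rightarrow>\<^sub>E lts_T \<Sigma> Z"
  shows "lts_kcomp \<Sigma> X Y Z g (sharp lts_eta X Y f) = (\<lambda>x\<in>X. g (f x))"
proof (rule lts_hom_eqI)
  show "lts_kcomp \<Sigma> X Y Z g (sharp lts_eta X Y f) \<in> X \<rightarrow>\<^sub>E lts_T \<Sigma> Z"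
    by (rule lts_kcomp_hom)
  show "(\<lambda>x\<in>X. g (f x)) \<in> X \<rightarrow>\<^sub>E lts_T \<Sigma> Z"
    using assms by auto
  fix x \<sigma> z assume x: "x \<in> X"
  have "sharp lts_eta X Y f \<in> X \<rightarrow>\<^sub>E lts_T \<Sigma> Y"
    using assms(1) by (auto simp: sharp_lts_eta lts_T_def labels_def)
  then show "(\<sigma>, z) \<in> lts_kcomp \<Sigma> X Y Z g (sharp lts_eta X Y f) x \<longleftrightarrow> (\<sigma>, z) \<in> (\<lambda>x\<in>X. g (f x)) x"
    using assms x by (auto simp: lts_kcomp_iff sharp_lts_eta)
qed

text \<open>The induced morphism adds only the label \<open>None\<close>, so labels survive and only
  targets are renamed by f.\<close>

lemma lts_kcomp_sharp_left:
  assumes "f \<in> Y \<rightarrow>\<^sub>E Z" "g \<in> X \<rightarrow>\<^sub>E lts_T \<Sigma> Y" "x \<in> X"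
  shows "lts_kcomp \<Sigma> X Y Z (sharp lts_eta Y Z f) g x = {(\<sigma>, f y) |\<sigma> y. (\<sigma>, y) \<in> g x}"
proof -
  have "sharp lts_eta Y Z f \<in> Y \<rightarrow>\<^sub>E lts_T \<Sigma> Z"
    using assms(1) by (auto simp: sharp_lts_eta lts_T_def labels_def)
  note iff = lts_kcomp_iff[OF assms(2) this assms(3)]
  have "(\<rho>, z) \<in> sharp lts_eta Y Z f y \<longleftrightarrow> \<rho> = None \<and> z = f y" if "(\<pi>, y) \<in> g x" for \<pi> \<rho> y z
    using lts_hom_closed(2)[OF assms(2,3) that] by (simp add: sharp_lts_eta[OF assms(1)])
  then have "(\<sigma>, z) \<in> lts_kcomp \<Sigma> X Y Z (sharp lts_eta Y Z f) g x \<longleftrightarrow>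
      (\<exists>y. z = f y \<and> (\<sigma>, y) \<in> g x)" for \<sigma> z
    unfolding iff by metis
  then show ?thesis by auto
qed

section \<open>Transfer of runs along maps, and leastness\<close>

lemma weak_step_forward:
  assumes "weak_step \<alpha> x \<sigma> z" "\<alpha> \<in> X \<rightarrow>\<^sub>E lts_T \<Sigma> X" "x \<in> X"
    and step: "\<And>y \<rho> w. \<lbrakk>y \<in> X; (\<rho>, w) \<in> \<alpha> y\<rbrakk> \<Longrightarrow> (\<rho>, f w) \<in> \<beta> (f y)"
  shows "weak_step \<beta> (f x) \<sigma> (f z)"
  using assms(1)
proof (induction rule: weak_step.induct)
  case refl
  show ?case by (rule weak_step.refl)
next
  case (silent \<sigma> y z)
  then show ?case
    using weak_step_closed[OF _ assms(2,3)] step weak_step.silent by metis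
next
  case (visible y \<sigma> z)
  then show ?case
    using weak_step_closed[OF _ assms(2,3)] step weak_step.visible by metis
qed

text \<open>A run of \<beta> from f x is lifted step by step: once its current state is f z for a
  lifted run ending in z, the next step leaves f z and \<open>step\<close> lifts it to a step out of
  z.\<close>

lemma weak_step_backward:
  assumes "weak_step \<beta> (f x) \<sigma> y" "\<alpha> \<in> X \<rightarrow>\<^sub>E lts_T \<Sigma> X" "x \<in> X"
    and step: "\<And>x \<rho> w. \<lbrakk>x \<in> X; (\<rho>, w) \<in> \<beta> (f x)\<rbrakk> \<Longrightarrow> \<exists>x'. w = f x' \<and> (\<rho>, x') \<in> \<alpha> x"
  shows "\<exists>z. y = f z \<and> weak_step \<alpha> x \<sigma> z"
  using assms(1)
proof (induction rule: weak_step.induct)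
  case refl
  show ?case by (blast intro: weak_step.refl)
next
  case (silent \<sigma> y z)
  then show ?case
    using weak_step_closed[OF _ assms(2,3)] step weak_step.silent by metis
next
  case (visible y \<sigma> z)
  then show ?case
    using weak_step_closed[OF _ assms(2,3)] step weak_step.visible by metis
qed

lemma weak_step_least:
  assumes "weak_step \<alpha> x \<sigma> z" "\<alpha> \<in> X \<rightarrow>\<^sub>E lts_T \<Sigma> X" "\<beta> \<in> X \<rightarrow>\<^sub>E lts_T \<Sigma> X" "x \<in> X"
    and "lts_le X X (lts_eta X) \<beta>" "lts_le X X \<alpha> \<beta>" "lts_le X X (lts_kcomp \<Sigma> X X X \<beta> \<beta>) \<beta>"
  shows "(\<sigma>, z) \<in> \<beta> x"
proof -
  have unit: "(None, x) \<in> \<beta> x"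
    using assms(4,5) by (auto simp: lts_le_def lts_eta_def)
  have step: "(\<rho>, w) \<in> \<beta> y" if "y \<in> X" "(\<rho>, w) \<in> \<alpha> y" for y \<rho> w
    using assms(6) that by (auto simp: lts_le_def)
  \<comment> \<open>Pointwise form of \<beta> absorbing its own square; the first disjunct serves
    the case \<open>silent\<close> below, the second the case \<open>visible\<close>.\<close>
  have comp: "(\<rho>, w) \<in> \<beta> x"
    if "(\<rho>, y) \<in> \<beta> x \<and> (None, w) \<in> \<beta> y \<or> (None, y) \<in> \<beta> x \<and> (\<rho>, w) \<in> \<beta> y" for y \<rho> w
    using assms(7) that lts_kcomp_iff[OF assms(3,3,4)] assms(4) unfolding lts_le_def by blast
  show ?thesis
    using assms(1)
  proof (induction rule: weak_step.induct)
    case refl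
    show ?case by (rule unit)
  next
    case (silent \<sigma> y z)
    then show ?case
      using weak_step_closed[OF _ assms(2,4)] step comp by metis
  next
    case (visible y \<sigma> z)
    then show ?case
      using weak_step_closed[OF _ assms(2,4)] step comp by metis
  qed
qed

section \<open>Verification of the axioms\<close>

lemma lts_set_monad:
  "set_monad (lts_T \<Sigma> :: 'u set \<Rightarrow> ('s option \<times> 'u) set set) lts_eta (lts_kcomp \<Sigma>)"
proof
  fix X Y :: "'u set" and f :: "'u \<Rightarrow> ('s option \<times> 'u) set"
  assume f: "f \<in> X \<rightarrow>\<^sub>E lts_T \<Sigma> Y"
  show "lts_kcomp \<Sigma> X Y Y (lts_eta Y) f = f"
  proof (rule lts_hom_eqI[OF lts_kcomp_hom f])
    fix x \<sigma> y assume "x \<in> X"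
    then show "(\<sigma>, y) \<in> lts_kcomp \<Sigma> X Y Y (lts_eta Y) f x \<longleftrightarrow> (\<sigma>, y) \<in> f x"
      using lts_hom_closed[OF f] by (auto simp: lts_kcomp_def lts_eta_def)
  qed
  show "lts_kcomp \<Sigma> X X Y f (lts_eta X) = f"
    by (rule lts_hom_eqI[OF lts_kcomp_hom f])
      (auto simp: lts_kcomp_def lts_eta_def dest: lts_hom_closed[OF f])
next
  fix W X Y Z :: "'u set" and f g h :: "'u \<Rightarrow> ('s option \<times> 'u) set"
  assume f: "f \<in> W \<rightarrow>\<^sub>E lts_T \<Sigma> X" and g: "g \<in> X \<rightarrow>\<^sub>E lts_T \<Sigma> Y" and h: "h \<in> Y \<rightarrow>\<^sub>E lts_T \<Sigma> Z"
  show "lts_kcomp \<Sigma> W X Z (lts_kcomp \<Sigma> X Y Z h g) f = lts_kcomp \<Sigma> W Y Z h (lts_kcomp \<Sigma> W X Y g f)"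
  proof (rule lts_hom_eqI[OF lts_kcomp_hom lts_kcomp_hom])
    fix x \<sigma> z assume x: "x \<in> W"
    \<comment> \<open>\<open>lts_kcomp_iff\<close> needs y in X, which holds because y is a target
      of f.\<close>
    have hg: "(\<rho>, w) \<in> lts_kcomp \<Sigma> X Y Z h g y \<longleftrightarrow>
        (\<exists>v. (\<rho>, v) \<in> g y \<and> (None, w) \<in> h v \<or> (None, v) \<in> g y \<and> (\<rho>, w) \<in> h v)"
      if "(\<pi>, y) \<in> f x" for \<pi> \<rho> y w
      using lts_kcomp_iff[OF g h] lts_hom_closed(2)[OF f x that] by blast
    \<comment> \<open>Both sides describe paths through f, g and h in which one factor carries
      \<sigma> and the other two carry \<open>None\<close>.\<close>
    show "(\<sigma>, z) \<in> lts_kcomp \<Sigma> W X Z (lts_kcomp \<Sigma> X Y Z h g) f x \<longleftrightarrow>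
        (\<sigma>, z) \<in> lts_kcomp \<Sigma> W Y Z h (lts_kcomp \<Sigma> W X Y g f) x"
      unfolding lts_kcomp_iff[OF f lts_kcomp_hom x] lts_kcomp_iff[OF lts_kcomp_hom h x]
        lts_kcomp_iff[OF f g x]
      using hg by blast
  qed
qed (rule lts_eta_hom lts_kcomp_hom lts_kcomp_sharp_right; assumption)+

lemma lts_ordered_set_monad:
  "ordered_set_monad (lts_T \<Sigma> :: 'u set \<Rightarrow> ('s option \<times> 'u) set set) lts_eta (lts_kcomp \<Sigma>) lts_le"
proof (intro ordered_set_monad.intro lts_set_monad ordered_set_monad_axioms.intro)
  fix X Y :: "'u set" and f g :: "'u \<Rightarrow> ('s option \<times> 'u) set"
  assume "f \<in> X \<rightarrow>\<^sub>E lts_T \<Sigma> Y" "g \<in> X \<rightarrow>\<^sub>E lts_T \<Sigma> Y" "lts_le X Y f g" "lts_le X Y g f"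
  then show "f = g"
    by (intro lts_hom_eqI) (auto simp: lts_le_def)
\<comment> \<open>For monotonicity, the bound on the middle state in \<open>lts_kcomp\<close> lets
  the inequality between the second factors be applied.\<close>
qed (fastforce simp: lts_le_def lts_kcomp_def)+

theorem theorem5p11:
  fixes \<Sigma> :: "'s set"
  shows "ordered_saturation_monad
    (lts_T \<Sigma> :: 'u set \<Rightarrow> ('s option \<times> 'u) set set)
    lts_eta (lts_kcomp \<Sigma>) lts_le (lts_sat \<Sigma>)"
proof (intro ordered_saturation_monad.intro lts_ordered_set_monad
    ordered_saturation_monad_axioms.intro)
  fix X :: "'u set" and \<alpha> :: "'u \<Rightarrow> ('s option \<times> 'u) set"
  assume \<alpha>: "\<alpha> \<in> X \<rightarrow>\<^sub>E lts_T \<Sigma> X"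
  show "lts_sat \<Sigma> X \<alpha> \<in> X \<rightarrow>\<^sub>E lts_T \<Sigma> X"
    by (rule lts_sat_hom[OF \<alpha>])
  show "lts_le X X (lts_eta X) (lts_sat \<Sigma> X \<alpha>)"
    by (auto simp: lts_le_def lts_eta_def lts_sat_eq_weak_step[OF \<alpha>] intro: weak_step.refl)
  \<comment> \<open>\<open>visible\<close> admits every label, \<open>None\<close> included, so one
    rule after \<open>refl\<close> covers each single step.\<close>
  show "lts_le X X \<alpha> (lts_sat \<Sigma> X \<alpha>)"
    by (auto simp: lts_le_def lts_sat_eq_weak_step[OF \<alpha>]
        intro: weak_step.visible[OF weak_step.refl])
  show "lts_le X X (lts_kcomp \<Sigma> X X X (lts_sat \<Sigma> X \<alpha>) (lts_sat \<Sigma> X \<alpha>)) (lts_sat \<Sigma> X \<alpha>)"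
    by (auto simp: lts_le_def lts_kcomp_def lts_sat_eq_weak_step[OF \<alpha>]
        intro: weak_step_trans_left weak_step_trans_right)
next
  fix X :: "'u set" and \<alpha> \<beta> :: "'u \<Rightarrow> ('s option \<times> 'u) set"
  assume "\<alpha> \<in> X \<rightarrow>\<^sub>E lts_T \<Sigma> X" "\<beta> \<in> X \<rightarrow>\<^sub>E lts_T \<Sigma> X"
    "lts_le X X (lts_eta X) \<beta>" "lts_le X X \<alpha> \<beta>" "lts_le X X (lts_kcomp \<Sigma> X X X \<beta> \<beta>) \<beta>"
  \<comment> \<open>Only the goal's instance of \<open>lts_le\<close> is unfolded, so the
    assumptions keep the form that \<open>weak_step_least\<close> expects.\<close>
  then show "lts_le X X (lts_sat \<Sigma> X \<alpha>) \<beta>"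
    using weak_step_least by (fastforce simp: lts_le_def[of X X "lts_sat \<Sigma> X \<alpha>"] lts_sat_eq_weak_step)
next
  fix X Y :: "'u set" and f and \<alpha> \<beta> :: "'u \<Rightarrow> ('s option \<times> 'u) set"
  assume \<alpha>: "\<alpha> \<in> X \<rightarrow>\<^sub>E lts_T \<Sigma> X" and \<beta>: "\<beta> \<in> Y \<rightarrow>\<^sub>E lts_T \<Sigma> Y" and f: "f \<in> X \<rightarrow>\<^sub>E Y"
  have fX: "f x \<in> Y" if "x \<in> X" for x
    using f that by auto
  \<comment> \<open>These equations turn every inequality below into a pointwise statement about
    steps or runs.\<close>
  note simps = lts_le_def lts_kcomp_sharp_left[OF f \<alpha>] lts_kcomp_sharp_right[OF f \<beta>]
    lts_kcomp_sharp_left[OF f lts_sat_hom[OF \<alpha>]] lts_kcomp_sharp_right[OF f lts_sat_hom[OF \<beta>]]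
    lts_sat_eq_weak_step[OF \<alpha>] lts_sat_eq_weak_step[OF \<beta> fX]
  show "lts_le X Y (lts_kcomp \<Sigma> X X Y (sharp lts_eta X Y f) (lts_sat \<Sigma> X \<alpha>))
      (lts_kcomp \<Sigma> X Y Y (lts_sat \<Sigma> Y \<beta>) (sharp lts_eta X Y f))"
    if "lts_le X Y (lts_kcomp \<Sigma> X X Y (sharp lts_eta X Y f) \<alpha>)
      (lts_kcomp \<Sigma> X Y Y \<beta> (sharp lts_eta X Y f))"
  proof -
    \<comment> \<open>The hypothesis says that f preserves single steps.\<close>
    have "(\<rho>, f w) \<in> \<beta> (f y)" if "y \<in> X" "(\<rho>, w) \<in> \<alpha> y" for y \<rho> w
      using \<open>lts_le _ _ _ _\<close> that by (auto simp: simps)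
    note fwd = weak_step_forward[where f = f and \<beta> = \<beta>, OF _ \<alpha> _ this]
    show ?thesis
      by (auto simp: simps intro: fwd)
  qed
  show "lts_le X Y (lts_kcomp \<Sigma> X Y Y (lts_sat \<Sigma> Y \<beta>) (sharp lts_eta X Y f))
      (lts_kcomp \<Sigma> X X Y (sharp lts_eta X Y f) (lts_sat \<Sigma> X \<alpha>))"
    if "lts_le X Y (lts_kcomp \<Sigma> X Y Y \<beta> (sharp lts_eta X Y f))
      (lts_kcomp \<Sigma> X X Y (sharp lts_eta X Y f) \<alpha>)"
  proof -
    \<comment> \<open>Here it says that each \<beta>-step out of f x is the image of an
      \<alpha>-step out of x.\<close>
    have "\<exists>x'. w = f x' \<and> (\<rho>, x') \<in> \<alpha> x" if "x \<in> X" "(\<rho>, w) \<in> \<beta> (f x)" for x \<rho> w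
      using \<open>lts_le _ _ _ _\<close> that by (force simp: simps)
    note bwd = weak_step_backward[where f = f and \<beta> = \<beta>, OF _ \<alpha> _ this]
    show ?thesis
      by (auto simp: simps dest: bwd)
  qed
qed

end
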